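(* Let $n > 3$ be an integer and let $k$ be a real number with $k \ge -n$. Then the polynomial $$A_{n}(x) + k\,x\,A_{n-2}(x)$$ has only real zeros, where $A_m(x)=\sum_{\sigma\in\mathfrak{S}_m}x^{\operatorname{des}\sigma}$ denotes the $m$-th Eulerian polynomial.
   Context: For a positive integer $m$, $\mathfrak{S}_m$ denotes the set of permutations $\sigma=(\sigma_1,\ldots,\sigma_m)$ of $[m]=\{1,2,\ldots,m\}$. For $\sigma\in\mathfrak{S}_m$, the descent set is $\operatorname{Des}\sigma=\{i\in[m-1] : \sigma_i>\sigma_{i+1}\}$, and $\operatorname{des}\sigma=|\operatorname{Des}\sigma|$ is the number of descents. The Eulerian polynomial is $A_m(x)=\sum_{\sigma\in\mathfrak{S}_m}x^{\operatorname{des}\sigma}$ (so $A_1(x)=1$, $A_2(x)=1+x$, with no extra factor of $x$). A polynomial with real coefficients "has only real zeros" if all of its complex zeros are real. *)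

theory Defs
  imports
    Complex_Main
    "HOL-Computational_Algebra.Polynomial"
    "HOL-Combinatorics.Permutations"
begin

(* A permutation of {1..m} is a function that fixes every point outside {1..m}
   (the library's "permutes"), so its domain size m has to be passed explicitly. *)

definition Des :: "nat \<Rightarrow> (nat \<Rightarrow> nat) \<Rightarrow> nat set" where
  "Des m \<sigma> = {i \<in> {1..m - 1}. \<sigma> i > \<sigma> (i + 1)}"

definition des :: "nat \<Rightarrow> (nat \<Rightarrow> nat) \<Rightarrow> nat" where
  "des m \<sigma> = card (Des m \<sigma>)"

definition eulerian_poly :: "nat \<Rightarrow> real poly" where
  "eulerian_poly m = (\<Sum>\<sigma> | \<sigma> permutes {1..m}. monom 1 (des m \<sigma>))"

definition only_real_zeros :: "real poly \<Rightarrow> bool" where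
  "only_real_zeros p \<longleftrightarrow> (\<forall>z::complex. poly (map_poly of_real p) z = 0 \<longrightarrow> z \<in> \<real>)"

end

theory Submission
  imports Defs "HOL-Combinatorics.Multiset_Permutations"
begin

text \<open>
  The substitution \<open>x = - (1 + w) / (1 - w)\<close> maps the interval \<open>(-1, 1)\<close> bijectively onto the negative
  half-line, and turns the Eulerian polynomials into the derivatives of the hyperbolic tangent: if
  \<open>w = tanh s\<close>, then the \<open>(m + 1)\<close>-st derivative of \<open>tanh\<close> at \<open>s\<close> is \<open>(1 - w\<^sup>2) Q\<^sub>m(w)\<close> with
  \<open>Q\<^sub>0 = 1\<close> and \<open>Q\<^sub>m\<^sub>+\<^sub>1 = ((1 - w\<^sup>2) Q\<^sub>m)'\<close>, and \<open>A\<^sub>m\<^sub>+\<^sub>1(x) (1 - w)\<^sup>m = Q\<^sub>m(w)\<close>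
  (lemma \<open>eulerian_tanh_poly\<close>). This rests on the classical recurrence
  \<open>A\<^sub>m\<^sub>+\<^sub>1 = (1 + m x) A\<^sub>m + x (1 - x) A\<^sub>m'\<close>, which comes from inserting the largest letter into a
  permutation.

  Put \<open>n = m + 3\<close>, \<open>h = (1 - w\<^sup>2) Q\<^sub>m\<close> and \<open>Q = Q\<^sub>m\<^sub>+\<^sub>2\<close>. Since \<open>(1 - w)\<^sup>2 x = - (1 - w\<^sup>2)\<close>, the
  polynomial \<open>A\<^sub>n + k x A\<^sub>n\<^sub>-\<^sub>2\<close> becomes \<open>R = Q - k h\<close>, and it is enough to find \<open>n - 1\<close>
  zeros of \<open>R\<close> in \<open>(-1, 1)\<close>. By Rolle's theorem \<open>V = (1 - w\<^sup>2) h'\<close> has \<open>n\<close> simple zeros in \<open>[-1, 1]\<close>,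
  and \<open>V' = Q\<close>, so \<open>Q\<close> alternates in sign along them. It remains to see that \<open>R\<close> has the sign of
  \<open>Q\<close> at each of these points. At the endpoints \<open>h = 0\<close> and \<open>R = Q\<close>. At a zero \<open>w\<close> of \<open>h'\<close>,
  \<open>Q = (1 - w\<^sup>2) h''\<close>, and the partial fractions of \<open>h' / h\<close> over the \<open>m + 2\<close> zeros \<open>a\<close> of \<open>h\<close> give
  \<open>- Q / h = m + 2 + (\<Sum>a. (1 - a\<^sup>2) / (w - a)\<^sup>2)\<close>
  (lemma \<open>second_pderiv_at_critical_point\<close>). If this is larger than \<open>n = m + 3\<close>, then
  \<open>Q\<close> dominates \<open>k h\<close> for negative \<open>k \<ge> - n\<close>, while for \<open>k \<ge> 0\<close> the two terms of \<open>R\<close> have equal sign.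
  So one zero \<open>a\<close> with \<open>(w - a)\<^sup>2 < 1 - a\<^sup>2\<close> suffices, and it exists because \<open>Q\<^sub>m\<close> has a pair of zeros
  \<open>\<plusminus>a\<close> with \<open>0 \<le> a \<le> 2/3\<close> (lemma \<open>tanh_poly_small_root\<close>).
\<close>

(* Linear and quadratic factors are kept intact: multiplying them out would hide the
   product structure that the lemmas on derivatives refer to. *)
declare mult_pCons_left [simp del]

section \<open>The recurrence for Eulerian polynomials\<close>

fun descents :: "'a::linorder list \<Rightarrow> nat" where
  "descents (x # y # zs) = (if y < x then 1 else 0) + descents (y # zs)"
| "descents _ = 0"

fun insertions :: "'a \<Rightarrow> 'a list \<Rightarrow> 'a list list" where
  "insertions a [] = [[a]]"
| "insertions a (x # xs) = (a # x # xs) # map ((#) x) (insertions a xs)"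

lemma descents_upt:
  "descents (map f [a..<b]) = card {i \<in> {a..<b - 1}. f (i + 1) < f i}"
proof (induction "b - a" arbitrary: a)
  case 0
  then show ?case by simp
next
  case (Suc k)
  show ?case
  proof (cases "Suc a < b")
    case False
    with Suc(2) have "[a..<b] = [a]" by (simp add: upt_rec)
    moreover from False Suc(2) have "b = Suc a" by simp
    ultimately show ?thesis by simp
  next
    case True
    then have upt: "[a..<b] = a # Suc a # [Suc (Suc a)..<b]" "[Suc a..<b] = Suc a # [Suc (Suc a)..<b]"
      by (simp_all add: upt_rec)
    have "{i \<in> {a..<b - 1}. f (i + 1) < f i} =
        (if f (Suc a) < f a then {a} else {}) \<union> {i \<in> {Suc a..<b - 1}. f (i + 1) < f i}"
      using True by (auto simp: not_less_eq_eq le_less_Suc_eq Suc_le_eq le_less)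
    then have "card {i \<in> {a..<b - 1}. f (i + 1) < f i} =
        (if f (Suc a) < f a then 1 else 0) + card {i \<in> {Suc a..<b - 1}. f (i + 1) < f i}"
      by simp
    also have "card {i \<in> {Suc a..<b - 1}. f (i + 1) < f i} = descents (map f [Suc a..<b])"
      using Suc by simp
    finally show ?thesis using upt by simp
  qed
qed

lemma bij_betw_permutes_lists:
  "bij_betw (\<lambda>\<sigma>. map \<sigma> [1..<Suc m]) {\<sigma>. \<sigma> permutes {1..m}} (permutations_of_set {1..m})"
proof -
  let ?l = "\<lambda>\<sigma>. map \<sigma> [1..<Suc m]"
  have range: "set [1..<Suc m] = {1..m}" by auto
  have inj: "inj_on ?l {\<sigma>. \<sigma> permutes {1..m}}"
  proof (intro inj_onI ext)
    fix \<sigma> \<tau> i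
    assume "\<sigma> \<in> {\<sigma>. \<sigma> permutes {1..m}}" "\<tau> \<in> {\<sigma>. \<sigma> permutes {1..m}}" "?l \<sigma> = ?l \<tau>"
    then show "\<sigma> i = \<tau> i"
      using range by (cases "i \<in> {1..m}") (auto simp: permutes_not_in simp del: upt_Suc)
  qed
  have sub: "?l ` {\<sigma>. \<sigma> permutes {1..m}} \<subseteq> permutations_of_set {1..m}"
  proof safe
    fix \<sigma> assume p: "\<sigma> permutes {1..m}"
    show "?l \<sigma> \<in> permutations_of_set {1..m}"
      using permutes_image[OF p] permutes_inj_on[OF p] range
      by (intro permutations_of_setI) (simp_all add: distinct_map del: upt_Suc)
  qed
  have "card (?l ` {\<sigma>. \<sigma> permutes {1..m}}) = card (permutations_of_set {1..m})"
    by (simp add: card_image[OF inj] card_permutations del: upt_Suc One_nat_def)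
  then have "?l ` {\<sigma>. \<sigma> permutes {1..m}} = permutations_of_set {1..m}"
    using sub by (intro card_subset_eq) auto
  with inj show ?thesis by (simp add: bij_betw_def)
qed

lemma poly_eulerian:
  "poly (eulerian_poly m) x = (\<Sum>xs\<in>permutations_of_set {1..m}. x ^ descents xs)"
proof -
  have "descents (map \<sigma> [1..<Suc m]) = des m \<sigma>" for \<sigma>
  proof -
    have "{1..<m} = {1..m - 1}" by auto
    then show ?thesis by (simp add: descents_upt des_def Des_def del: upt_Suc)
  qed
  then have "poly (eulerian_poly m) x =
      (\<Sum>\<sigma> | \<sigma> permutes {1..m}. x ^ descents (map \<sigma> [1..<Suc m]))"
    by (simp add: eulerian_poly_def poly_sum poly_monom del: upt_Suc)
  also have "\<dots> = (\<Sum>xs\<in>permutations_of_set {1..m}. x ^ descents xs)"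
    by (rule sum.reindex_bij_betw[OF bij_betw_permutes_lists])
  finally show ?thesis .
qed

lemma set_insertions: "set (insertions a xs) = {us @ a # vs | us vs. xs = us @ vs}"
proof (induction xs)
  case (Cons x xs)
  show ?case
  proof (intro equalityI subsetI)
    fix ys assume "ys \<in> set (insertions a (x # xs))"
    then consider "ys = [] @ a # (x # xs)"
      | us vs where "ys = (x # us) @ a # vs" "x # xs = (x # us) @ vs"
      by (auto simp: Cons.IH)
    then show "ys \<in> {us @ a # vs |us vs. x # xs = us @ vs}"
      by cases (blast, blast)
  next
    fix ys assume "ys \<in> {us @ a # vs |us vs. x # xs = us @ vs}"
    then obtain us vs where "ys = us @ a # vs" "x # xs = us @ vs" by blast
    moreover from this Cons.IH have "us' @ a # vs \<in> set (insertions a xs)" if "us = x # us'" for us'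
      using that by auto
    ultimately show "ys \<in> set (insertions a (x # xs))"
      by (cases us) auto
  qed
qed simp

lemma distinct_insertions: "a \<notin> set xs \<Longrightarrow> distinct (insertions a xs)"
  by (induction xs) (auto simp: distinct_map)

text \<open>
  Deleting \<open>a\<close> inverts the insertion, so the union on the right is disjoint; this is what lets
  statistics on permutations be summed one letter at a time.
\<close>

lemma permutations_of_set_insert:
  assumes "finite A" "a \<notin> A"
  shows "permutations_of_set (insert a A) = (\<Union>xs\<in>permutations_of_set A. set (insertions a xs))"
proof (intro equalityI subsetI)
  fix ys assume ys: "ys \<in> permutations_of_set (insert a A)"
  then obtain us vs where *: "ys = us @ a # vs"
    using split_list[of a ys] by (auto simp: permutations_of_set_def)
  with ys assms have "us @ vs \<in> permutations_of_set A"
    by (auto simp: permutations_of_set_def)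
  with * show "ys \<in> (\<Union>xs\<in>permutations_of_set A. set (insertions a xs))"
    by (auto simp: set_insertions)
next
  fix ys assume "ys \<in> (\<Union>xs\<in>permutations_of_set A. set (insertions a xs))"
  with assms show "ys \<in> permutations_of_set (insert a A)"
    by (auto simp: set_insertions permutations_of_set_def)
qed

text \<open>
  A new maximum \<open>a\<close> creates no further descent exactly when it is put into one of the existing descents or
  at the end; each of the other positions creates one more.
\<close>

lemma sum_descents_insertions:
  fixes x :: real
  assumes "\<forall>y\<in>set xs. y < a"
  shows "(\<Sum>ys\<leftarrow>insertions a xs. x ^ descents ys) =
    (1 + real (descents xs)) * x ^ descents xs
      + (real (length xs) - real (descents xs)) * x ^ Suc (descents xs)"
  using assms
proof (induction xs rule: descents.induct)
  case (1 y z zs)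
  define d where "d = descents (z # zs)"
  \<comment> \<open>\<open>S\<close> collects the insertions strictly behind \<open>z\<close>; there the pair \<open>y, z\<close> stays adjacent.\<close>
  have "\<not> a < y" "z < a" using 1(2) by auto
  define S where "S = (\<Sum>ys\<leftarrow>insertions a zs. x ^ descents (z # ys))"
  have "(\<Sum>ys\<leftarrow>insertions a (z # zs). x ^ descents ys) = x ^ Suc d + S"
    using 1(2) by (simp add: d_def S_def comp_def)
  with 1 have S: "x ^ Suc d + S = (1 + real d) * x ^ d + (real (length (z # zs)) - real d) * x ^ Suc d"
    by (simp add: d_def)
  have *: "(\<Sum>ys\<leftarrow>insertions a zs. x ^ descents (y # z # ys)) = x ^ (if z < y then 1 else 0) * S"
    by (simp add: S_def sum_list_const_mult power_add)
  have T: "(\<Sum>ys\<leftarrow>insertions a (y # z # zs). x ^ descents ys) =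
      x ^ Suc (descents (y # z # zs)) + x ^ Suc d + x ^ (if z < y then 1 else 0) * S"
    using \<open>\<not> a < y\<close> \<open>z < a\<close> 1(2) by (simp add: d_def * [symmetric] comp_def)
  have S': "S = (1 + real d) * x ^ d + (real (length zs) - real d) * x ^ Suc d"
    using S by (simp add: algebra_simps)
  have desc: "descents (y # z # zs) = (if z < y then Suc d else d)"
    by (simp add: d_def)
  show ?case
    unfolding T S' desc by (simp add: algebra_simps)
qed (auto simp: algebra_simps)

lemma eulerian_recurrence:
  "poly (eulerian_poly (Suc m)) x =
     (1 + real m * x) * poly (eulerian_poly m) x
       + x * (1 - x) * poly (pderiv (eulerian_poly m)) x"
proof -
  let ?P = "permutations_of_set {1..m}"
  have "poly (pderiv (eulerian_poly m)) x =
      (\<Sum>xs\<in>?P. real (descents xs) * x ^ (descents xs - 1))"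
  proof (rule DERIV_unique)
    have "poly (eulerian_poly m) = (\<lambda>x. \<Sum>xs\<in>?P. x ^ descents xs)"
      by (rule ext) (rule poly_eulerian)
    with poly_DERIV[of "eulerian_poly m" x]
    show "((\<lambda>x. \<Sum>xs\<in>?P. x ^ descents xs) has_real_derivative poly (pderiv (eulerian_poly m)) x) (at x)"
      by simp
    show "((\<lambda>x. \<Sum>xs\<in>?P. x ^ descents xs) has_real_derivative
        (\<Sum>xs\<in>?P. real (descents xs) * x ^ (descents xs - 1))) (at x)"
      by (auto intro!: derivative_eq_intros sum.cong)
  qed
  moreover have "poly (eulerian_poly (Suc m)) x =
      (\<Sum>xs\<in>?P. (1 + real m * x) * x ^ descents xs
         + x * (1 - x) * (real (descents xs) * x ^ (descents xs - 1)))"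
  proof -
    have "poly (eulerian_poly (Suc m)) x =
        (\<Sum>ys\<in>permutations_of_set (insert (Suc m) {1..m}). x ^ descents ys)"
      by (simp add: poly_eulerian atLeastAtMostSuc_conv)
    also have "\<dots> = (\<Sum>xs\<in>?P. \<Sum>ys\<in>set (insertions (Suc m) xs). x ^ descents ys)"
    proof (subst permutations_of_set_insert, simp, simp, rule sum.UNION_disjoint)
      have "remove1 (Suc m) ys = xs" if "xs \<in> ?P" "ys \<in> set (insertions (Suc m) xs)" for xs ys
      proof -
        from that(2) obtain us vs where "ys = us @ Suc m # vs" "xs = us @ vs"
          by (auto simp: set_insertions)
        moreover from that(1) have "Suc m \<notin> set xs"
          by (auto simp: permutations_of_set_def)
        ultimately show ?thesis by (simp add: remove1_append)
      qed
      then show "\<forall>xs\<in>?P. \<forall>xs'\<in>?P. xs \<noteq> xs' \<longrightarrow>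
          set (insertions (Suc m) xs) \<inter> set (insertions (Suc m) xs') = {}"
        by blast
    qed auto
    also have "\<dots> = (\<Sum>xs\<in>?P. (1 + real m * x) * x ^ descents xs
         + x * (1 - x) * (real (descents xs) * x ^ (descents xs - 1)))"
    proof (rule sum.cong[OF refl])
      fix xs assume xs: "xs \<in> ?P"
      then have len: "length xs = m" and bd: "\<forall>y\<in>set xs. y < Suc m"
        by (auto simp: length_finite_permutations_of_set permutations_of_set_def)
      have "Suc m \<notin> set xs" using bd by auto
      then have "(\<Sum>ys\<in>set (insertions (Suc m) xs). x ^ descents ys) =
          (\<Sum>ys\<leftarrow>insertions (Suc m) xs. x ^ descents ys)"
        by (simp add: sum_list_distinct_conv_sum_set distinct_insertions)
      also note sum_descents_insertions[OF bd]
      finally show "(\<Sum>ys\<in>set (insertions (Suc m) xs). x ^ descents ys) =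
          (1 + real m * x) * x ^ descents xs
            + x * (1 - x) * (real (descents xs) * x ^ (descents xs - 1))"
        by (cases "descents xs") (simp_all add: len algebra_simps)
    qed
    finally show ?thesis .
  qed
  ultimately show ?thesis
    by (simp add: poly_eulerian sum.distrib sum_distrib_left)
qed

lemma poly_eulerian_0 [simp]: "poly (eulerian_poly m) 0 = 1"
proof (induction m)
  case (Suc m)
  then show ?case using eulerian_recurrence[of m 0] by simp
qed (simp add: poly_eulerian)

lemma degree_eulerian: "degree (eulerian_poly m) \<le> m - 1"
  unfolding eulerian_poly_def
proof (rule degree_sum_le)
  fix \<sigma>
  have "Des m \<sigma> \<subseteq> {1..m - 1}" by (auto simp: Des_def)
  from card_mono[OF _ this] show "degree (monom 1 (des m \<sigma>) :: real poly) \<le> m - 1"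
    by (simp add: degree_monom_eq des_def)
qed (simp add: finite_permutations)


section \<open>Passing to derivatives of the hyperbolic tangent\<close>

text \<open>
  In terms of \<open>w = tanh s\<close>, the derivation \<open>d/ds\<close> is \<open>(1 - w\<^sup>2) d/dw\<close>, so \<open>(1 - w\<^sup>2) * tanh_poly m\<close>
  evaluated at \<open>tanh s\<close> is the \<open>(m + 1)\<close>-st derivative of \<open>tanh\<close>.
\<close>

fun tanh_poly :: "nat \<Rightarrow> real poly" where
  "tanh_poly 0 = 1"
| "tanh_poly (Suc m) = pderiv ([:1, 0, -1:] * tanh_poly m)"

lemma poly_pderiv_one_minus_square_mult:
  "poly (pderiv ([:1, 0, -1:] * p)) w = (1 - w\<^sup>2) * poly (pderiv p) w - 2 * w * poly p (w :: real)"
  unfolding pderiv_mult by (simp add: pderiv_pCons power2_eq_square algebra_simps)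

text \<open>
  Under \<open>x = - (1 + w) / (1 - w)\<close> one has \<open>dx/dw = - 2 / (1 - w)\<^sup>2\<close> and \<open>x (1 - x) = - 2 (1 + w) / (1 - w)\<^sup>2\<close>.
  Differentiating the identity for \<open>m\<close> therefore expresses the derivative term of the Eulerian recurrence
  through \<open>tanh_poly m\<close>, and the recurrence turns into that of \<open>tanh_poly\<close>.
\<close>

lemma eulerian_tanh_poly:
  assumes "w \<noteq> 1"
  shows "poly (eulerian_poly (Suc m)) (- (1 + w) / (1 - w)) * (1 - w) ^ m = poly (tanh_poly m) w"
  using assms
proof (induction m arbitrary: w)
  case 0
  then show ?case by (simp add: poly_eulerian)
next
  case (Suc m)
  let ?A = "eulerian_poly (Suc m)" and ?Q = "tanh_poly m"
  define x where "x = - (1 + w) / (1 - w)"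
  define a where "a = poly ?A x"
  define a' where "a' = poly (pderiv ?A) x"
  define q where "q = poly ?Q w"
  define q' where "q' = poly (pderiv ?Q) w"
  define t where "t = (1 - w) ^ m"
  have w: "1 - w \<noteq> 0" using Suc.prems by simp
  have q: "a * t = q" using Suc.IH[OF Suc.prems] by (simp add: a_def x_def t_def q_def)
  have q': "q' = a' * (- 2 / (1 - w)\<^sup>2) * t - a * (real m * (1 - w) ^ (m - 1))"
  proof (rule DERIV_unique)
    show "(poly ?Q has_real_derivative q') (at w)"
      unfolding q'_def by (rule poly_DERIV)
    have dx: "((\<lambda>w. - (1 + w) / (1 - w)) has_real_derivative - 2 / (1 - w)\<^sup>2) (at w)"
      using w by (auto intro!: derivative_eq_intros simp: power2_eq_square field_simps)
    have dA: "((\<lambda>w. poly ?A (- (1 + w) / (1 - w))) has_real_derivative a' * (- 2 / (1 - w)\<^sup>2)) (at w)"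
      unfolding a'_def x_def by (rule DERIV_chain2[OF poly_DERIV dx])
    have "((\<lambda>w. poly ?A (- (1 + w) / (1 - w)) * (1 - w) ^ m) has_real_derivative
        a' * (- 2 / (1 - w)\<^sup>2) * t - a * (real m * (1 - w) ^ (m - 1))) (at w)"
      unfolding a_def t_def x_def
      by (rule derivative_eq_intros dA refl | simp)+
    then show "(poly ?Q has_real_derivative
        a' * (- 2 / (1 - w)\<^sup>2) * t - a * (real m * (1 - w) ^ (m - 1))) (at w)"
      by (rule has_field_derivative_transform_within_open[where S = "- {1}"])
        (use Suc in auto)
  qed
  have "real m * (1 - w) ^ (m - 1) * (1 - w) = real m * t"
    by (cases m) (simp_all add: t_def)
  then have t': "real m * (1 - w) ^ (m - 1) = real m * t / (1 - w)"
    using w by (simp add: field_simps)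
  have "poly (eulerian_poly (Suc (Suc m))) x * (1 - w) ^ Suc m =
      ((1 + real (Suc m) * x) * a + x * (1 - x) * a') * ((1 - w) * t)"
    by (simp add: eulerian_recurrence[of "Suc m"] a_def a'_def t_def)
  also have "\<dots> = (1 - w\<^sup>2) * q' - 2 * w * q"
    unfolding q' t' q[symmetric] x_def using w
    by (simp add: divide_simps) (simp add: power2_eq_square algebra_simps)
  also have "\<dots> = poly (tanh_poly (Suc m)) w"
    by (simp add: q_def q'_def poly_pderiv_one_minus_square_mult)
  finally show ?case by (simp only: x_def)
qed

section \<open>Polynomials with simple real roots\<close>

text \<open>
  A counting principle used twice below: with \<open>P\<close> the zeros of a derivative (Rolle's theorem), and with \<open>P\<close>
  the zeros of a polynomial that changes sign between neighbouring elements of \<open>T\<close>.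
\<close>

lemma exists_roots_in_gaps:
  fixes T :: "'a::linorder set"
  assumes "finite T" "T \<noteq> {}"
    and "\<And>a b. a \<in> T \<Longrightarrow> b \<in> T \<Longrightarrow> a < b \<Longrightarrow> {a<..<b} \<inter> T = {} \<Longrightarrow> \<exists>z>a. z < b \<and> P z"
  shows "\<exists>U. finite U \<and> Suc (card U) = card T \<and> (\<forall>z\<in>U. Min T < z \<and> z < Max T \<and> P z)"
  using assms
proof (induction T rule: finite_linorder_max_induct)
  case (insert b T)
  show ?case
  proof (cases "T = {}")
    case True
    then show ?thesis by (intro exI[of _ "{}"]) simp
  next
    case False
    have "\<exists>z>a. z < c \<and> P z" if "a \<in> T" "c \<in> T" "a < c" "{a<..<c} \<inter> T = {}" for a c
    proof (rule insert.prems)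
      show "{a<..<c} \<inter> insert b T = {}" using that insert.hyps(2) by force
    qed (use that in auto)
    from insert.IH[OF False this] obtain U
      where U: "finite U" "Suc (card U) = card T" "\<forall>z\<in>U. Min T < z \<and> z < Max T \<and> P z"
      by blast
    have Max: "Max T \<in> T" "Max T < b" using False insert.hyps by auto
    have "\<exists>z>Max T. z < b \<and> P z"
    proof (rule insert.prems)
      show "{Max T<..<b} \<inter> insert b T = {}"
      proof (rule equals0I)
        fix y assume "y \<in> {Max T<..<b} \<inter> insert b T"
        then have "y \<in> T" "Max T < y" by auto
        with Max_ge[OF insert.hyps(1), of y] show False by (simp add: not_le[symmetric])
      qed
    qed (use Max in auto)
    then obtain z where z: "Max T < z" "z < b" "P z" by blast
    have "Min T \<le> Max T" using Max insert.hyps(1) by simp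
    moreover have "Min (insert b T) = Min T" "Max (insert b T) = b"
      using le_less_trans[OF \<open>Min T \<le> Max T\<close> Max(2)] Max(2)
      unfolding Min_insert[OF insert.hyps(1) False] Max_insert[OF insert.hyps(1) False]
      by (simp_all only: min.absorb4 max.absorb3)
    moreover have "Min T < z" using \<open>Min T \<le> Max T\<close> z(1) by (rule le_less_trans)
    moreover have "z \<notin> U" using U(3) z(1) by auto
    moreover have "b \<notin> T" using insert.hyps by auto
    ultimately show ?thesis
      using U z Max insert.hyps(1)
      by (intro exI[of _ "insert z U"]) auto
  qed
qed simp

text \<open>
  Having as many distinct real roots as the degree means splitting over the reals without repeated roots.
\<close>

definition split_simple :: "real poly \<Rightarrow> bool" where
  "split_simple p \<longleftrightarrow> p \<noteq> 0 \<and> card {x. poly p x = 0} = degree p"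

lemma split_simple_factor:
  assumes "split_simple p"
  shows "p = smult (lead_coeff p) (\<Prod>a | poly p a = 0. [:- a, 1:])"
proof -
  have nz: "p \<noteq> 0" and card: "card {x. poly p x = 0} = degree p"
    using assms by (auto simp: split_simple_def)
  let ?S = "{x. poly p x = 0}"
  have "finite S \<Longrightarrow> S \<subseteq> ?S \<Longrightarrow> (\<Prod>a\<in>S. [:- a, 1:]) dvd p" for S
  proof (induction S rule: finite_induct)
    case (insert a S)
    then obtain r where r: "p = (\<Prod>b\<in>S. [:- b, 1:]) * r" by auto
    have "poly (\<Prod>b\<in>S. [:- b, 1:]) a \<noteq> 0"
      using insert.hyps by (simp add: poly_prod)
    moreover have "poly p a = 0" using insert.prems by auto
    ultimately have "poly r a = 0" by (subst (asm) r) simp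
    then have "[:- a, 1:] dvd r" by (simp add: poly_eq_0_iff_dvd)
    then have "[:- a, 1:] * (\<Prod>b\<in>S. [:- b, 1:]) dvd r * (\<Prod>b\<in>S. [:- b, 1:])"
      by (rule mult_dvd_mono) simp
    then show ?case
      by (simp only: prod.insert[OF insert.hyps] r mult.commute[of _ r])
  qed simp
  from this[OF poly_roots_finite[OF nz] subset_refl] obtain r
    where r: "p = (\<Prod>a\<in>?S. [:- a, 1:]) * r" by auto
  have ne: "(\<Prod>a\<in>?S. [:- a, 1:]) \<noteq> 0" "r \<noteq> 0" using r nz by auto
  have deg: "degree (\<Prod>a\<in>?S. [:- a, 1:]) = card ?S"
    by (subst degree_prod_eq_sum_degree) (auto simp: poly_roots_finite[OF nz])
  have "degree p = card ?S + degree r"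
    using degree_mult_eq[OF ne] deg r by simp
  with card have "degree r = 0" by simp
  then obtain c where c: "r = [:c:]" by (auto elim: degree_eq_zeroE)
  define q where "q = (\<Prod>a\<in>?S. [:- a, 1:])"
  have pc: "p = smult c q" using r c by (simp add: q_def)
  have "lead_coeff (smult c q) = c"
    by (simp add: lead_coeff_smult q_def lead_coeff_prod)
  then have "lead_coeff p = c" unfolding pc[symmetric] .
  with pc show ?thesis by (simp add: q_def)
qed

lemma pderiv_linear_mult: "pderiv ([:- a, 1:] * r) = r + [:- a, 1:] * pderiv (r :: real poly)"
  by (simp add: pderiv_mult pderiv_pCons)

lemma poly_pderiv_linear_mult:
  "poly (pderiv ([:- a, 1:] * r)) x = poly r x + (x - a) * poly (pderiv r) (x :: real)"
  unfolding pderiv_linear_mult by (simp add: algebra_simps)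

text \<open>
  If \<open>p'(a) = 0\<close> at a root \<open>a\<close>, then \<open>p / (x - a)\<close> still vanishes at every root of \<open>p\<close>, too many
  for its degree.
\<close>

lemma split_simple_pderiv_nz:
  assumes "split_simple p" "poly p a = 0"
  shows "poly (pderiv p) a \<noteq> 0"
proof
  assume d: "poly (pderiv p) a = 0"
  obtain r where r: "p = [:- a, 1:] * r" using assms(2) by (auto simp: poly_eq_0_iff_dvd)
  have nz: "p \<noteq> 0" "r \<noteq> 0" using assms(1) r by (auto simp: split_simple_def)
  have "poly r a = 0" using d by (simp add: r poly_pderiv_linear_mult)
  then have "{x. poly p x = 0} = {x. poly r x = 0}" by (auto simp: r)
  then have "degree p \<le> degree r"
    using card_poly_roots_bound[OF nz(2)] assms(1) by (simp add: split_simple_def)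
  moreover have "degree p = Suc (degree r)" using nz(2) by (simp add: r degree_mult_eq)
  ultimately show False by simp
qed

text \<open>
  Write \<open>p = (x - a) (x - b) r\<close>. Then \<open>p'(a) = (a - b) r(a)\<close> and \<open>p'(b) = (b - a) r(b)\<close>, where
  \<open>r\<close> keeps its sign between \<open>a\<close> and \<open>b\<close>.
\<close>

lemma pderiv_sign_alternates:
  fixes p :: "real poly"
  assumes "a < b" "poly p a = 0" "poly p b = 0"
    and nz: "\<And>x. a < x \<Longrightarrow> x < b \<Longrightarrow> poly p x \<noteq> 0"
    and "poly (pderiv p) a \<noteq> 0" "poly (pderiv p) b \<noteq> 0"
  shows "poly (pderiv p) a * poly (pderiv p) b < 0"
proof -
  obtain s where s: "p = [:- a, 1:] * s" using assms(2) by (auto simp: poly_eq_0_iff_dvd)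
  have "poly s b = 0" using assms(1,3) by (simp add: s)
  then obtain r where r: "s = [:- b, 1:] * r" by (auto simp: poly_eq_0_iff_dvd)
  have da: "poly (pderiv p) a = (a - b) * poly r a" and db: "poly (pderiv p) b = (b - a) * poly r b"
    by (simp_all add: s r poly_pderiv_linear_mult)
  have "\<not> poly r a * poly r b < 0"
    using poly_IVT[OF \<open>a < b\<close>, of r] nz by (auto simp: s r)
  moreover have "poly r a \<noteq> 0" "poly r b \<noteq> 0" using assms(5,6) da db by auto
  ultimately have "poly r a * poly r b > 0" by (simp add: not_less le_less)
  then have "(a - b) * (b - a) * (poly r a * poly r b) < 0"
    using \<open>a < b\<close> by (intro mult_neg_pos mult_neg_pos) auto
  then show ?thesis by (simp add: da db mult_ac)
qed

lemma prod_linear_pderivs: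
  fixes w :: real
  assumes "finite S" "w \<notin> S"
  defines "p \<equiv> \<Prod>a\<in>S. [:- a, 1:]"
  shows "poly (pderiv p) w = poly p w * (\<Sum>a\<in>S. 1 / (w - a)) \<and>
    poly (pderiv (pderiv p)) w =
      poly p w * ((\<Sum>a\<in>S. 1 / (w - a))\<^sup>2 - (\<Sum>a\<in>S. 1 / (w - a)\<^sup>2))"
  unfolding p_def using assms(1,2)
proof (induction S rule: finite_induct)
  case (insert b S)
  let ?q = "\<Prod>a\<in>S. [:- a, 1:]"
  define L where "L = (\<Sum>a\<in>S. 1 / (w - a))"
  define M where "M = (\<Sum>a\<in>S. 1 / (w - a)\<^sup>2)"
  define q where "q = poly ?q w"
  have IH: "poly (pderiv ?q) w = q * L" "poly (pderiv (pderiv ?q)) w = q * (L\<^sup>2 - M)"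
    using insert by (auto simp: L_def M_def q_def)
  define u where "u = 1 / (w - b)"
  have u: "(w - b) * u = 1" using insert.prems by (simp add: u_def)
  have u2: "1 / (w - b)\<^sup>2 = u\<^sup>2" by (simp add: u_def power_one_over)
  have "(w - b) * q * (u + L) = (w - b) * u * q + (w - b) * (q * L)"
    and "(w - b) * q * ((u + L)\<^sup>2 - (u\<^sup>2 + M)) =
      2 * ((w - b) * u) * (q * L) + (w - b) * (q * (L\<^sup>2 - M))"
    by (simp_all add: power2_eq_square algebra_simps)
  note this[unfolded u]
  then show ?case
    unfolding sum.insert[OF insert.hyps] prod.insert[OF insert.hyps]
      L_def[symmetric] M_def[symmetric] u_def[symmetric] u2
    unfolding pderiv_linear_mult pderiv_add by (simp add: IH algebra_simps flip: q_def)
qed simp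

lemma split_simple_pderivs:
  assumes "split_simple p" "poly p w \<noteq> 0"
  shows "poly (pderiv p) w = poly p w * (\<Sum>a | poly p a = 0. 1 / (w - a))"
    and "poly (pderiv (pderiv p)) w = poly p w *
      ((\<Sum>a | poly p a = 0. 1 / (w - a))\<^sup>2 - (\<Sum>a | poly p a = 0. 1 / (w - a)\<^sup>2))"
proof -
  define S where "S = {a. poly p a = 0}"
  define c where "c = lead_coeff p"
  have p: "p = smult c (\<Prod>a\<in>S. [:- a, 1:])"
    unfolding S_def c_def by (rule split_simple_factor[OF assms(1)])
  have "finite S" using assms(1) by (simp add: S_def split_simple_def poly_roots_finite)
  moreover have "w \<notin> S" using assms(2) by (simp add: S_def)
  ultimately have *: "poly (pderiv p) w = poly p w * (\<Sum>a\<in>S. 1 / (w - a)) \<and>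
    poly (pderiv (pderiv p)) w =
      poly p w * ((\<Sum>a\<in>S. 1 / (w - a))\<^sup>2 - (\<Sum>a\<in>S. 1 / (w - a)\<^sup>2))"
    using prod_linear_pderivs[of S w] unfolding p by (simp add: pderiv_smult)
  then show "poly (pderiv p) w = poly p w * (\<Sum>a | poly p a = 0. 1 / (w - a))"
    and "poly (pderiv (pderiv p)) w = poly p w *
      ((\<Sum>a | poly p a = 0. 1 / (w - a))\<^sup>2 - (\<Sum>a | poly p a = 0. 1 / (w - a)\<^sup>2))"
    unfolding S_def by auto
qed

text \<open>
  At a critical point \<open>\<Sum>a. 1 / (w - a) = 0\<close>, so any multiple of this sum can be added to
  \<open>- p'' / p = (\<Sum>a. 1 / (w - a)\<^sup>2)\<close>. The multiple is chosen such that every summand becomes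
  \<open>(1 - w\<^sup>2) / (w - a)\<^sup>2 + 2 w / (w - a) = 1 + (1 - a\<^sup>2) / (w - a)\<^sup>2\<close>,
  which is at least 1 when \<open>\<bar>a\<bar> \<le> 1\<close>.
\<close>

lemma second_pderiv_at_critical_point:
  assumes "split_simple p" "poly p w \<noteq> 0" "poly (pderiv p) w = 0"
  shows "(1 - w\<^sup>2) * poly (pderiv (pderiv p)) w =
    - poly p w * (real (degree p) + (\<Sum>a | poly p a = 0. (1 - a\<^sup>2) / (w - a)\<^sup>2))"
proof -
  let ?S = "{a. poly p a = 0}"
  have L: "(\<Sum>a\<in>?S. 1 / (w - a)) = 0"
    using split_simple_pderivs(1)[OF assms(1,2)] assms(2,3) by simp
  have "(1 - w\<^sup>2) * (\<Sum>a\<in>?S. 1 / (w - a)\<^sup>2) + 2 * w * (\<Sum>a\<in>?S. 1 / (w - a)) =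
      (\<Sum>a\<in>?S. (1 - w\<^sup>2) / (w - a)\<^sup>2 + 2 * w / (w - a))"
    by (simp add: sum.distrib sum_distrib_left)
  also have "\<dots> = (\<Sum>a\<in>?S. 1 + (1 - a\<^sup>2) / (w - a)\<^sup>2)"
  proof (rule sum.cong[OF refl])
    fix a assume "a \<in> ?S"
    then have "w - a \<noteq> 0" using assms(2) by auto
    then show "(1 - w\<^sup>2) / (w - a)\<^sup>2 + 2 * w / (w - a) = 1 + (1 - a\<^sup>2) / (w - a)\<^sup>2"
      by (simp add: divide_simps) (simp add: power2_eq_square algebra_simps)
  qed
  also have "\<dots> = real (degree p) + (\<Sum>a\<in>?S. (1 - a\<^sup>2) / (w - a)\<^sup>2)"
    using assms(1) by (simp add: sum.distrib split_simple_def)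
  finally have "(1 - w\<^sup>2) * (\<Sum>a\<in>?S. 1 / (w - a)\<^sup>2) = \<dots>" by (simp add: L)
  then show ?thesis
    using split_simple_pderivs(2)[OF assms(1,2)] by (simp add: L mult_ac)
qed


section \<open>The roots of the derivatives of the hyperbolic tangent\<close>

abbreviation tanh_deriv :: "nat \<Rightarrow> real poly" where
  "tanh_deriv m \<equiv> [:1, 0, -1:] * tanh_poly m"

lemma tanh_poly_degree: "tanh_poly m \<noteq> 0 \<and> degree (tanh_poly m) = m"
proof (induction m)
  case (Suc m)
  then have "degree (tanh_deriv m) = Suc (Suc m)"
    by (simp add: degree_mult_eq)
  then have "degree (tanh_poly (Suc m)) = Suc m" by (simp add: degree_pderiv)
  then show ?case by (metis degree_0 nat.distinct(1))
qed simp

lemma tanh_deriv_degree: "tanh_deriv m \<noteq> 0 \<and> degree (tanh_deriv m) = m + 2"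
  using tanh_poly_degree[of m] by (simp add: degree_mult_eq no_zero_divisors del: tanh_poly.simps)

lemma tanh_deriv_roots:
  "{w. poly (tanh_deriv m) w = 0} = {-1, 1} \<union> {w. poly (tanh_poly m) w = 0}"
proof -
  have "1 + w * - w = 0 \<longleftrightarrow> w = -1 \<or> w = 1" for w :: real
    using square_eq_1_iff[of w] by auto
  then show ?thesis by (auto simp del: mult_minus_right)
qed

text \<open>
  Multiplying by \<open>1 - w\<^sup>2\<close> adds the roots \<open>\<plusminus>1\<close>, and Rolle's theorem then puts \<open>m + 1\<close> roots of the
  derivative strictly between these two; the degree leaves no room for others.
\<close>

lemma tanh_poly_roots:
  "split_simple (tanh_poly m) \<and> {w. poly (tanh_poly m) w = 0} \<subseteq> {-1<..<1}"
proof (induction m)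
  case 0
  then show ?case by (simp add: split_simple_def)
next
  case (Suc m)
  let ?S = "{w. poly (tanh_poly m) w = 0}" and ?T = "{w. poly (tanh_deriv m) w = 0}"
  have S: "finite ?S" "card ?S = m" "?S \<subseteq> {-1<..<1}"
    using Suc tanh_poly_degree[of m] by (auto simp: split_simple_def poly_roots_finite)
  have T: "?T = insert (-1) (insert 1 ?S)" using tanh_deriv_roots[of m] by auto
  have "-1 \<notin> insert 1 ?S" "1 \<notin> ?S" using S(3) by auto
  then have "finite ?T" "?T \<noteq> {}" "card ?T = Suc (Suc m)"
    unfolding T using S by auto
  moreover have "\<exists>z>a. z < b \<and> poly (tanh_poly (Suc m)) z = 0" if "a \<in> ?T" "b \<in> ?T" "a < b" for a b
    using poly_MVT[OF \<open>a < b\<close>, of "tanh_deriv m"] that by auto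
  ultimately obtain U where U: "finite U" "card U = Suc m"
    "\<forall>z\<in>U. Min ?T < z \<and> z < Max ?T \<and> poly (tanh_poly (Suc m)) z = 0"
    using exists_roots_in_gaps[of ?T "\<lambda>z. poly (tanh_poly (Suc m)) z = 0"] by auto
  have "Min ?T \<in> ?T" "Max ?T \<in> ?T" by (simp_all only: Min_in Max_in \<open>finite ?T\<close> \<open>?T \<noteq> {}\<close> not_False_eq_True)
  then have bounds: "-1 \<le> Min ?T" "Max ?T \<le> 1" unfolding T using S(3) by force+
  let ?R = "{w. poly (tanh_poly (Suc m)) w = 0}"
  note nz = tanh_poly_degree[of "Suc m"]
  have "U \<subseteq> ?R" using U by blast
  moreover have "card ?R \<le> card U"
    using card_poly_roots_bound[of "tanh_poly (Suc m)"] nz U(2) by simp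
  ultimately have R: "?R = U"
    using card_seteq[of ?R U] nz by (simp add: poly_roots_finite)
  have "split_simple (tanh_poly (Suc m))" using nz R U(2) by (simp add: split_simple_def)
  moreover have "?R \<subseteq> {-1<..<1}" unfolding R using U(3) bounds by fastforce
  ultimately show ?case by blast
qed

lemma tanh_deriv_split_simple: "split_simple (tanh_deriv m)"
proof -
  let ?S = "{w. poly (tanh_poly m) w = 0}"
  have "finite ?S" "card ?S = m" "?S \<subseteq> {-1<..<1}"
    using tanh_poly_roots[of m] tanh_poly_degree[of m] by (auto simp: split_simple_def poly_roots_finite)
  moreover from this have "-1 \<notin> insert 1 ?S" "1 \<notin> ?S" by auto
  moreover have "{w. poly (tanh_deriv m) w = 0} = insert (-1) (insert 1 ?S)"
    using tanh_deriv_roots[of m] by auto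
  ultimately show ?thesis
    unfolding split_simple_def using tanh_deriv_degree[of m] by simp
qed

lemma finite_tanh_deriv_roots: "finite {w. poly (tanh_deriv m) w = 0}"
  by (rule poly_roots_finite) (use tanh_deriv_degree in blast)

lemma tanh_poly_parity: "poly (tanh_poly m) (- w) = (- 1) ^ m * poly (tanh_poly m) w"
proof -
  have "pcompose (tanh_poly m) [:0, -1:] = smult ((- 1) ^ m) (tanh_poly m)"
  proof (induction m)
    case (Suc m)
    have "pcompose [:1, 0, -1:] [:0, -1:] = [:1, 0, -1 :: real:]"
      by (simp add: pcompose_pCons mult_pCons_left)
    then have comp: "pcompose (tanh_deriv m) [:0, -1:] = smult ((- 1) ^ m) (tanh_deriv m)"
      by (simp add: pcompose_mult Suc)
    have "pcompose (tanh_poly (Suc m)) [:0, -1:] = - pderiv (pcompose (tanh_deriv m) [:0, -1:])"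
      by (simp add: pderiv_pcompose pderiv_pCons)
    also note comp
    finally show ?case by (simp add: pderiv_smult)
  qed (simp add: pcompose_1)
  from arg_cong[OF this, of "\<lambda>p. poly p w"] show ?thesis by (simp add: poly_pcompose)
qed

text \<open>
  For odd \<open>m\<close> the root is 0. For even \<open>m\<close>, \<open>tanh_poly m\<close> is the derivative of an odd polynomial \<open>g\<close> whose
  roots include \<open>0\<close> and \<open>\<plusminus>1\<close>. If \<open>g\<close> were monotone on \<open>[0, 2/3]\<close>, then \<open>g' / g\<close> would be positive at
  \<open>c = 2/3\<close> and all roots of \<open>g\<close> other than 0 would be larger than \<open>c\<close> in absolute value. Adding the partial
  fractions \<open>1 / (c - a)\<close> and \<open>1 / (c + a)\<close> of opposite roots gives \<open>2 c / (c\<^sup>2 - a\<^sup>2)\<close>, negative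
  for \<open>a \<noteq> 0\<close>, and already \<open>a = \<plusminus>1\<close> outweigh \<open>a = 0\<close> as soon as \<open>c\<^sup>2 > 1/3\<close>.
\<close>

lemma tanh_poly_small_root:
  assumes "m > 0"
  shows "\<exists>a. 0 \<le> a \<and> a \<le> 2 / 3 \<and> poly (tanh_poly m) a = 0"
proof (cases "odd m")
  case True
  then have "poly (tanh_poly m) 0 = 0" using tanh_poly_parity[of m 0] by simp
  then show ?thesis by (intro exI[of _ 0]) simp
next
  case False
  with assms obtain l where m: "m = Suc l" and l: "odd l" by (cases m) auto
  let ?g = "tanh_deriv l"
  have par: "poly (tanh_poly l) (- w) = - poly (tanh_poly l) w" for w
    using tanh_poly_parity[of l w] l by simp
  have g': "pderiv ?g = tanh_poly m" by (simp add: m)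
  have odd: "poly ?g (- w) = - poly ?g w" for w by (simp add: par)
  have g0: "poly ?g 0 = 0" using odd[of 0] by simp
  show ?thesis
  proof (rule ccontr)
    assume "\<not> ?thesis"
    then have no: "poly (tanh_poly m) w \<noteq> 0" if "0 \<le> w" "w \<le> 2 / 3" for w using that by blast
    have pos: "poly ?g w * poly (tanh_poly m) (2 / 3) > 0" if "0 < w" "w \<le> 2 / 3" for w
    proof -
      obtain z where z: "0 < z" "z < w" "poly ?g w = w * poly (tanh_poly m) z"
        using poly_MVT[OF \<open>0 < w\<close>, of ?g] g0 unfolding g' by auto
      have "\<not> poly (tanh_poly m) z * poly (tanh_poly m) (2 / 3) < 0"
        using poly_IVT[of z "2 / 3" "tanh_poly m"] no z that by force
      moreover have "poly (tanh_poly m) z * poly (tanh_poly m) (2 / 3) \<noteq> 0"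
        using no z that by auto
      ultimately have "poly (tanh_poly m) z * poly (tanh_poly m) (2 / 3) > 0" by linarith
      with \<open>0 < w\<close> show ?thesis unfolding z(3) by (simp add: mult.assoc)
    qed
    let ?T = "{a. poly ?g a = 0}"
    define c :: real where "c = 2 / 3"
    have c: "poly ?g c * poly (pderiv ?g) c > 0" unfolding g' using pos[of c] by (simp add: c_def)
    then have gc: "poly ?g c \<noteq> 0" by auto
    have large: "c < \<bar>a\<bar>" if "a \<in> ?T" "a \<noteq> 0" for a
    proof (rule ccontr)
      assume "\<not> ?thesis"
      then have "0 < poly ?g \<bar>a\<bar> * poly (tanh_poly m) (2 / 3)"
        using that by (intro pos) (auto simp: c_def)
      moreover have "poly ?g \<bar>a\<bar> = 0" using that odd[of a] by (cases "a \<ge> 0") auto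
      ultimately show False by (simp only: mult_zero_left less_irrefl)
    qed
    let ?L = "\<Sum>a\<in>?T. 1 / (c - a)"
    have "poly ?g c * (poly ?g c * ?L) > 0"
      using c split_simple_pderivs(1)[OF tanh_deriv_split_simple gc] by simp
    then have Lpos: "?L > 0"
      using gc by (metis mult.assoc not_real_square_gt_zero zero_less_mult_pos)
    have "?L = (\<Sum>a\<in>?T. 1 / (c + a))"
      by (rule sum.reindex_bij_witness[of _ uminus uminus]) (use par in auto)
    then have "2 * ?L = (\<Sum>a\<in>?T. 1 / (c - a) + 1 / (c + a))"
      by (simp add: sum.distrib)
    also have "\<dots> \<le> (\<Sum>a\<in>{0, -1, 1}. 1 / (c - a) + 1 / (c + a))"
    proof -
      have sub: "{0, -1, 1} \<subseteq> ?T" using g0 by auto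
      note fin = finite_tanh_deriv_roots[of l]
      have "1 / (c - a) + 1 / (c + a) \<le> 0" if "a \<in> ?T - {0, -1, 1}" for a
      proof -
        from that large have a: "c < \<bar>a\<bar>" by auto
        then have "c\<^sup>2 < a\<^sup>2" by (metis abs_ge_zero abs_of_pos c_def abs_le_square_iff not_le
              zero_less_divide_iff zero_less_numeral)
        then have "(c - a) * (c + a) < 0" by (simp add: power2_eq_square algebra_simps)
        moreover from this have "1 / (c - a) + 1 / (c + a) = 2 * c / ((c - a) * (c + a))"
          by (auto simp: divide_simps)
        ultimately show ?thesis by (simp add: c_def divide_nonneg_neg)
      qed
      then have "(\<Sum>a\<in>?T - {0, -1, 1}. 1 / (c - a) + 1 / (c + a)) \<le> 0"
        by (intro sum_nonpos) blast
      with sum.subset_diff[OF sub fin, of "\<lambda>a. 1 / (c - a) + 1 / (c + a)"] show ?thesis by simp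
    qed
    also have "\<dots> < 0" by (simp add: c_def)
    finally show False using Lpos by simp
  qed
qed

text \<open>
  By \<open>second_pderiv_at_critical_point\<close> the ratio of the two polynomials at \<open>w\<close> is \<open>- (m + 2 + E)\<close>, where
  \<open>E\<close> is a sum of nonnegative terms over the roots. A root of absolute value at most \<open>2/3\<close> on the same side
  as \<open>w\<close> makes \<open>E > 1\<close>.
\<close>

lemma tanh_deriv_curvature:
  assumes "m > 0" "-1 < w" "w < 1" "poly (tanh_poly (Suc m)) w = 0"
  shows "poly (tanh_poly (m + 2)) w * poly (tanh_deriv m) w < - real (m + 3) * (poly (tanh_deriv m) w)\<^sup>2"
proof -
  let ?h = "tanh_deriv m"
  let ?T = "{a. poly ?h a = 0}"
  have crit: "poly (pderiv ?h) w = 0" using assms(4) by simp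
  have hw: "poly ?h w \<noteq> 0" using split_simple_pderiv_nz[OF tanh_deriv_split_simple] crit by blast
  define E where "E = (\<Sum>a\<in>?T. (1 - a\<^sup>2) / (w - a)\<^sup>2)"
  have "poly (tanh_poly (m + 2)) w = (1 - w\<^sup>2) * poly (pderiv (pderiv ?h)) w"
    using poly_pderiv_one_minus_square_mult[of "tanh_poly (Suc m)" w] assms(4) by simp
  also have "\<dots> = - poly ?h w * (real (m + 2) + E)"
    using second_pderiv_at_critical_point[OF tanh_deriv_split_simple hw crit] tanh_deriv_degree[of m]
    by (simp add: E_def)
  finally have Q: "poly (tanh_poly (m + 2)) w = - poly ?h w * (real (m + 2) + E)" .
  have eq: "poly (tanh_poly (m + 2)) w * poly ?h w = - (real (m + 2) + E) * (poly ?h w)\<^sup>2"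
    unfolding Q power2_eq_square by (simp only: mult_minus_left mult_ac)
  obtain r where r: "0 \<le> r" "r \<le> 2 / 3" "poly (tanh_poly m) r = 0"
    using tanh_poly_small_root[OF assms(1)] by blast
  define \<rho> where "\<rho> = (if w \<ge> 0 then r else - r)"
  have "poly (tanh_poly m) \<rho> = 0" using r(3) tanh_poly_parity[of m r] by (simp add: \<rho>_def)
  then have "\<rho> \<in> ?T" by simp
  then have "w - \<rho> \<noteq> 0" using hw by auto
  \<comment> \<open>Here \<open>r \<le> 2/3\<close> enters only through \<open>2 r\<^sup>2 < 1\<close>.\<close>
  have "(\<bar>w\<bar> - r)\<^sup>2 < 1 - r\<^sup>2"
  proof (cases "\<bar>w\<bar> \<ge> r")
    case True
    then have "(\<bar>w\<bar> - r)\<^sup>2 < (1 - r)\<^sup>2" using assms(2,3) by (intro power_strict_mono) auto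
    also have "(1 - r)\<^sup>2 \<le> 1 - r\<^sup>2"
    proof -
      have "r * r \<le> r * 1" using r by (intro mult_left_mono) auto
      then show ?thesis by (simp add: power2_eq_square algebra_simps)
    qed
    finally show ?thesis .
  next
    case False
    have "r\<^sup>2 \<le> (2 / 3)\<^sup>2" using r by (intro power_mono) auto
    then have "r\<^sup>2 < 1 - r\<^sup>2" by (simp add: power2_eq_square)
    moreover have "(\<bar>w\<bar> - r)\<^sup>2 \<le> r\<^sup>2" using False by (intro abs_le_square_iff[THEN iffD1]) auto
    ultimately show ?thesis by linarith
  qed
  then have "(w - \<rho>)\<^sup>2 < 1 - \<rho>\<^sup>2"
    by (cases "w \<ge> 0") (simp_all add: \<rho>_def power2_eq_square algebra_simps)
  then have "1 < (1 - \<rho>\<^sup>2) / (w - \<rho>)\<^sup>2" using \<open>w - \<rho> \<noteq> 0\<close> by (simp add: less_divide_eq)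
  also have "\<dots> \<le> E" unfolding E_def
  proof (rule member_le_sum[OF \<open>\<rho> \<in> ?T\<close>])
    fix a assume "a \<in> ?T - {\<rho>}"
    then have "a \<in> {-1, 1} \<or> a \<in> {-1<..<1}"
      using tanh_deriv_roots[of m] tanh_poly_roots[of m] by blast
    then have "\<bar>a\<bar> \<le> 1" by auto
    then have "0 \<le> 1 - a\<^sup>2" by (simp add: abs_square_le_1)
    then show "0 \<le> (1 - a\<^sup>2) / (w - a)\<^sup>2" by simp
  qed (rule finite_tanh_deriv_roots)
  finally have "E > 1" .
  then have "real (m + 3) * (poly ?h w)\<^sup>2 < (real (m + 2) + E) * (poly ?h w)\<^sup>2"
    using hw by (intro mult_strict_right_mono) auto
  then show ?thesis
    unfolding eq by (simp only: minus_mult_left[symmetric] neg_less_iff_less)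
qed

section \<open>Real zeros of the combination\<close>

text \<open>
  At \<open>w = \<plusminus>1\<close> the second term vanishes. At the other points let \<open>Q\<close> and \<open>h\<close> be the two values; by
  \<open>tanh_deriv_curvature\<close>, \<open>Q h\<close> and \<open>Q h + (m + 3) h\<^sup>2\<close> are both negative, and their product is
  \<open>h\<^sup>2 (Q\<^sup>2 + (m + 3) h Q)\<close>. This settles \<open>k = - (m + 3)\<close>, and a larger \<open>k\<close> only helps because
  \<open>h Q < 0\<close>.
\<close>

lemma combination_same_sign:
  assumes "m > 0" "k \<ge> - real (m + 3)" "poly (tanh_deriv (Suc m)) w = 0"
  shows "(poly (tanh_poly (m + 2)) w - k * poly (tanh_deriv m) w) * poly (tanh_poly (m + 2)) w > 0"
proof -
  define Q where "Q = poly (tanh_poly (m + 2)) w"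
  define h where "h = poly (tanh_deriv m) w"
  have "Q \<noteq> 0"
    using split_simple_pderiv_nz[OF tanh_deriv_split_simple assms(3)] by (simp add: Q_def)
  then have Q2: "Q\<^sup>2 > 0" by simp
  have "w \<in> {-1, 1} \<union> {w. poly (tanh_poly (Suc m)) w = 0}"
    using assms(3) tanh_deriv_roots[of "Suc m"] by blast
  then consider "h = 0" | "-1 < w" "w < 1" "poly (tanh_poly (Suc m)) w = 0"
    using tanh_poly_roots[of "Suc m"] unfolding h_def by fastforce
  then have "0 < Q\<^sup>2 - k * (h * Q)"
  proof cases
    case 1
    with Q2 show ?thesis by simp
  next
    case 2
    have *: "Q * h < - real (m + 3) * h\<^sup>2"
      using tanh_deriv_curvature[OF assms(1) 2] by (simp add: Q_def h_def)
    have neg: "Q * h < 0"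
    proof -
      have "0 \<le> real (m + 3) * h\<^sup>2" by (intro mult_nonneg_nonneg) auto
      with * show ?thesis by linarith
    qed
    have "Q * h + real (m + 3) * h\<^sup>2 < 0" using * by linarith
    with neg have "0 < (Q * h) * (Q * h + real (m + 3) * h\<^sup>2)"
      by (rule mult_neg_neg)
    also have "\<dots> = h\<^sup>2 * (Q\<^sup>2 + real (m + 3) * (h * Q))"
      by (simp add: power2_eq_square algebra_simps)
    finally have "0 < Q\<^sup>2 + real (m + 3) * (h * Q)"
      by (simp add: zero_less_mult_iff)
    also have "real (m + 3) * (h * Q) \<le> - k * (h * Q)"
      using assms(2) neg by (intro mult_right_mono_neg) (auto simp: mult.commute)
    finally show ?thesis by simp
  qed
  then show ?thesis by (simp add: Q_def h_def power2_eq_square algebra_simps)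
qed

text \<open>
  The combination changes sign between neighbouring roots of \<open>V = tanh_deriv (Suc m)\<close>: at these \<open>m + 3\<close>
  points it has the sign of \<open>tanh_poly (m + 2)\<close>, which is \<open>V'\<close>.
\<close>

lemma combination_roots:
  assumes "m > 0" "k \<ge> - real (m + 3)"
  shows "\<exists>U. finite U \<and> card U = m + 2 \<and>
    (\<forall>w\<in>U. -1 < w \<and> w < 1 \<and> poly (tanh_poly (m + 2)) w - k * poly (tanh_deriv m) w = 0)"
proof -
  define R where "R = tanh_poly (m + 2) - smult k (tanh_deriv m)"
  have R: "poly R w = poly (tanh_poly (m + 2)) w - k * poly (tanh_deriv m) w" for w
    by (simp add: R_def del: tanh_poly.simps)
  let ?V = "tanh_deriv (Suc m)"
  let ?T = "{w. poly ?V w = 0}"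
  have V': "pderiv ?V = tanh_poly (m + 2)" by simp
  have "finite ?T" by (rule finite_tanh_deriv_roots)
  have "card ?T = m + 3"
    using tanh_deriv_split_simple[of "Suc m"] tanh_deriv_degree[of "Suc m"]
    unfolding split_simple_def by linarith
  then have "?T \<noteq> {}" by (metis card.empty add_is_0 zero_neq_numeral)
  have "\<exists>z>a. z < b \<and> poly R z = 0"
    if "a \<in> ?T" "b \<in> ?T" "a < b" "{a<..<b} \<inter> ?T = {}" for a b
  proof (rule poly_IVT[OF \<open>a < b\<close>])
    have "poly (tanh_poly (m + 2)) a * poly (tanh_poly (m + 2)) b < 0"
      unfolding V'[symmetric]
      using that split_simple_pderiv_nz[OF tanh_deriv_split_simple, of "Suc m"]
      by (intro pderiv_sign_alternates[OF \<open>a < b\<close>]) auto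
    moreover have "poly R a * poly (tanh_poly (m + 2)) a > 0" "poly R b * poly (tanh_poly (m + 2)) b > 0"
      unfolding R using combination_same_sign[OF assms] that by blast+
    ultimately show "poly R a * poly R b < 0"
      by (auto simp: zero_less_mult_iff mult_less_0_iff)
  qed
  from exists_roots_in_gaps[OF \<open>finite ?T\<close> \<open>?T \<noteq> {}\<close> this] obtain U
    where U: "finite U" "Suc (card U) = card ?T" "\<forall>z\<in>U. Min ?T < z \<and> z < Max ?T \<and> poly R z = 0"
    by blast
  have T: "?T \<subseteq> {-1..1}"
  proof -
    have "{w. poly (tanh_poly (Suc m)) w = 0} \<subseteq> {-1<..<1}" using tanh_poly_roots by blast
    also have "{-1<..<1} \<subseteq> {-1..1 :: real}" by auto
    finally show ?thesis unfolding tanh_deriv_roots by simp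
  qed
  have "Min ?T \<in> ?T" "Max ?T \<in> ?T"
    by (simp_all only: Min_in Max_in \<open>finite ?T\<close> \<open>?T \<noteq> {}\<close> not_False_eq_True)
  then have "-1 \<le> Min ?T" "Max ?T \<le> 1" using T by (meson atLeastAtMost_iff subsetD)+
  with U \<open>card ?T = m + 3\<close> show ?thesis
    by (intro exI[of _ U]) (fastforce simp: R)
qed


lemma only_real_zerosI:
  assumes "p \<noteq> 0" "finite X" "degree p \<le> card X" "\<And>x. x \<in> X \<Longrightarrow> poly p x = 0"
  shows "only_real_zeros p"
  unfolding only_real_zeros_def
proof (intro allI impI)
  fix z :: complex
  let ?p = "map_poly of_real p :: complex poly"
  assume z: "poly ?p z = 0"
  show "z \<in> \<real>"
  proof (rule ccontr)
    assume "z \<notin> \<real>"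
    then have "z \<notin> of_real ` X" by auto
    have nz: "?p \<noteq> 0" using assms(1) by (simp add: map_poly_eq_0_iff)
    have "poly ?p (of_real x) = 0" if "x \<in> X" for x
    proof -
      have "poly (map_poly of_real q) (of_real x) = (of_real (poly q x) :: complex)" for q
        by (induction q) (simp_all add: map_poly_pCons)
      then show ?thesis using assms(4)[OF that] by simp
    qed
    with z have "insert z (of_real ` X) \<subseteq> {y. poly ?p y = 0}" by blast
    from card_mono[OF poly_roots_finite[OF nz] this]
    have "card (insert z (of_real ` X)) \<le> degree ?p"
      using card_poly_roots_bound[OF nz] by (rule order_trans)
    moreover have "card (insert z (of_real ` X)) = Suc (card X)"
      using \<open>z \<notin> of_real ` X\<close> assms(2) by (simp add: card_image inj_on_def)
    moreover have "degree ?p = degree p" by (simp add: degree_map_poly)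
    ultimately show False using assms(3) by simp
  qed
qed


theorem theorem1p3:
  fixes n :: nat and k :: real
  assumes "n > 3" and "k \<ge> - real n"
  shows "only_real_zeros (eulerian_poly n + smult k (monom 1 1 * eulerian_poly (n - 2)))"
proof -
  define m where "m = n - 3"
  have n: "n = Suc (m + 2)" "n - 2 = Suc m" and m: "m > 0" using assms(1) by (auto simp: m_def)
  let ?p = "eulerian_poly n + smult k (monom 1 1 * eulerian_poly (n - 2))"
  define \<xi> :: "real \<Rightarrow> real" where "\<xi> = (\<lambda>w. - (1 + w) / (1 - w))"
  obtain U where U: "finite U" "card U = m + 2"
    "\<And>w. w \<in> U \<Longrightarrow> -1 < w \<and> w < 1 \<and> poly (tanh_poly (m + 2)) w - k * poly (tanh_deriv m) w = 0"
    using combination_roots[of m k] m assms(2) n by auto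
  show ?thesis
  proof (rule only_real_zerosI[where X = "\<xi> ` U"])
    have "poly ?p 0 = 1" by (simp add: poly_monom)
    then show "?p \<noteq> 0" by (metis poly_0 zero_neq_one)
    show "finite (\<xi> ` U)" using U(1) by simp
    have "inj_on \<xi> U"
    proof (rule inj_onI)
      fix v w assume "v \<in> U" "w \<in> U" "\<xi> v = \<xi> w"
      then show "v = w" using U(3)[of v] U(3)[of w] by (simp add: \<xi>_def field_simps)
    qed
    then have "card (\<xi> ` U) = n - 1" using U(2) n by (simp add: card_image)
    moreover have "degree ?p \<le> n - 1"
    proof (rule degree_add_le)
      show "degree (eulerian_poly n) \<le> n - 1" by (rule degree_eulerian)
      have "degree (monom 1 1 * eulerian_poly (n - 2)) \<le> 1 + (n - 2 - 1)"
        using degree_eulerian[of "n - 2"] by (intro degree_mult_le[THEN order_trans] add_mono)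
          (auto simp: degree_monom_eq)
      then show "degree (smult k (monom 1 1 * eulerian_poly (n - 2))) \<le> n - 1"
        using degree_smult_le[of k "monom 1 1 * eulerian_poly (n - 2)"] n by simp
    qed
    ultimately show "degree ?p \<le> card (\<xi> ` U)" by simp
  next
    fix x assume "x \<in> \<xi> ` U"
    then obtain w where w: "w \<in> U" "x = \<xi> w" by blast
    then have w1: "1 - w \<noteq> 0" "w \<noteq> 1" using U(3) by force+
    have A: "poly (eulerian_poly (Suc j)) x * (1 - w) ^ j = poly (tanh_poly j) w" for j
      unfolding w(2) \<xi>_def by (rule eulerian_tanh_poly[OF w1(2)])
    have sq: "x * (1 - w)\<^sup>2 = - (1 - w\<^sup>2)"
      unfolding w(2) \<xi>_def using w1 by (simp add: power2_eq_square field_simps)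
    have "k * x * poly (eulerian_poly (Suc m)) x * (1 - w) ^ (m + 2) =
        k * (x * (1 - w)\<^sup>2 * (poly (eulerian_poly (Suc m)) x * (1 - w) ^ m))"
      by (simp add: power_add power2_eq_square mult_ac)
    also have "\<dots> = - k * poly (tanh_deriv m) w"
      unfolding A sq by (simp add: power2_eq_square algebra_simps)
    finally have B: "k * x * poly (eulerian_poly (Suc m)) x * (1 - w) ^ (m + 2) =
        - k * poly (tanh_deriv m) w" .
    have "poly ?p x * (1 - w) ^ (m + 2) = poly (eulerian_poly (Suc (m + 2))) x * (1 - w) ^ (m + 2)
        + k * x * poly (eulerian_poly (Suc m)) x * (1 - w) ^ (m + 2)"
      unfolding n(2) unfolding n(1) by (simp add: poly_monom algebra_simps)
    then have "poly ?p x * (1 - w) ^ (m + 2) =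
        poly (tanh_poly (m + 2)) w - k * poly (tanh_deriv m) w"
      unfolding A B by simp
    also have "\<dots> = 0" using U(3)[OF w(1)] by blast
    finally show "poly ?p x = 0" using w1 by simp
  qed
qed

end
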